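(* Let $n\ge1$, let $Q$ be a real symmetric positive-definite $2n\times2n$ matrix and let $B\in\mathbb{R}^{2n}$, so that $(Q,B)\in PH_n$. For any $m\ge n$ there exists an orthogonal matrix $O\in O(2m,\mathbb{R})$ such that, with $$(Q',B')=\left(O\begin{bmatrix}Q&0\\0&\mathbb{I}_{2m-2n}\end{bmatrix}O^T,\ O\begin{bmatrix}B\\0\end{bmatrix}\right)\in PH_m,$$ the following hold: (i) the filter induced by $(Q',B')$ coincides with the filter induced by $(Q,B)$; (ii) the map $f:\mathbb{R}^{2n}\to\mathbb{R}^{2m}$ defined by $f({\bf z})=O\begin{bmatrix}\mathbb{I}_{2n}\\0\end{bmatrix}{\bf z}$ is an injective system morphism from the state space of $(Q,B)$ to the state space of $(Q',B')$.
   Context: For each $k\ge1$, $\mathbb{J}_k=\begin{bmatrix}0&\mathbb{I}_k\\-\mathbb{I}_k&0\end{bmatrix}$. $PH_k$ is the set of linear port-Hamiltonian systems in normal form of dimension $2k$, identified with pairs $(Q,B)$, where $Q$ is a real symmetric positive-definite $2k\times 2k$ matrix and $B\in\mathbb{R}^{2k}$; the pair stands for the system $\dot{\bf z}=\mathbb{J}_kQ{\bf z}+Bu$, $y=B^TQ{\bf z}$, with ${\bf z}\in\mathbb{R}^{2k}$ and $u,y\in\mathbb{R}$. The filter (input/output system) induced by $(Q,B)\in PH_k$ is the family of maps $u\mapsto U_{(Q,B)}(u,{\bf x}_0)$, ${\bf x}_0\in\mathbb{R}^{2k}$, from $C^1([0,1])$ to $C^1([0,1])$ given by $$U_{(Q,B)}(u,{\bf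 x}_0)_t=B^TQe^{\mathbb{J}_kQt}\left[\int_0^te^{-\mathbb{J}_kQs}Bu(s)\,ds+{\bf x}_0\right],\quad t\in[0,1].$$ Two systems (possibly of different dimensions) induce the same filter when the sets of input/output maps $\{U(\cdot,{\bf x}_0)\}$, with ${\bf x}_0$ ranging over the respective state space, are equal. A system morphism from $\dot{\bf z}_1=F_1({\bf z}_1,u),\ y=h_1({\bf z}_1)$ to $\dot{\bf z}_2=F_2({\bf z}_2,u),\ y=h_2({\bf z}_2)$ is a map $f$ between the state spaces with $f(F_1({\bf z}_1,u))=F_2(f({\bf z}_1),u)$ and $h_1({\bf z}_1)=h_2(f({\bf z}_1))$ for all ${\bf z}_1$ and $u$. *)

theory Defs
  imports "HOL-Analysis.Analysis" "Jordan_Normal_Form.Matrix"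
begin

(* Vectors and matrices are those of Jordan_Normal_Form, whose dimensions are terms; the
   type-indexed vectors of HOL-Analysis are hidden to avoid ambiguous syntax. *)
unbundle no vec_syntax and no inner_syntax
hide_const (open) Finite_Cartesian_Product.vec Finite_Cartesian_Product.row
  Finite_Cartesian_Product.column Finite_Cartesian_Product.rows Finite_Cartesian_Product.columns
  Finite_Cartesian_Product.mat Finite_Cartesian_Product.vec_nth
  Finite_Cartesian_Product.transpose
hide_type (open) Finite_Cartesian_Product.vec

definition J_mat :: "nat \<Rightarrow> real mat" where
  "J_mat k = four_block_mat (0\<^sub>m k k) (1\<^sub>m k) (- 1\<^sub>m k) (0\<^sub>m k k)"

definition pos_def_mat :: "nat \<Rightarrow> real mat \<Rightarrow> bool" where
  "pos_def_mat d Q \<longleftrightarrow>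
     Q \<in> carrier_mat d d \<and> transpose_mat Q = Q \<and>
     (\<forall>x \<in> carrier_vec d. x \<noteq> 0\<^sub>v d \<longrightarrow> x \<bullet> (Q *\<^sub>v x) > 0)"

(* The library predicate orthogonal_mat only asks for pairwise orthogonal nonzero columns,
   not for columns of norm one. *)
definition orthogonal_group :: "nat \<Rightarrow> real mat set" where
  "orthogonal_group d = {A \<in> carrier_mat d d. transpose_mat A * A = 1\<^sub>m d}"

definition PH :: "nat \<Rightarrow> (real mat \<times> real vec) set" where
  "PH k = {(Q, B). pos_def_mat (2 * k) Q \<and> B \<in> carrier_vec (2 * k)}"

record ('z, 'u, 'y) io_system =
  states :: "'z set"
  dyn :: "'z \<Rightarrow> 'u \<Rightarrow> 'z"
  readout :: "'z \<Rightarrow> 'y"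

definition system_morphism ::
  "('z, 'u, 'y) io_system \<Rightarrow> ('w, 'u, 'y) io_system \<Rightarrow> ('z \<Rightarrow> 'w) \<Rightarrow> bool" where
  "system_morphism S T f \<longleftrightarrow>
     (\<forall>z \<in> states S. f z \<in> states T) \<and>
     (\<forall>z \<in> states S. \<forall>u. f (dyn S z u) = dyn T (f z) u \<and> readout S z = readout T (f z))"

fun PH_system :: "nat \<Rightarrow> real mat \<times> real vec \<Rightarrow> (real vec, real, real) io_system" where
  "PH_system k (Q, B) =
     \<lparr> states = carrier_vec (2 * k),
       dyn = (\<lambda>z u. (J_mat k * Q) *\<^sub>v z + u \<cdot>\<^sub>v B),
       readout = (\<lambda>z. B \<bullet> (Q *\<^sub>v z)) \<rparr>"

(* The exponential series of a square matrix, taken entrywise; it converges for every A. *)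
definition mat_exp :: "real mat \<Rightarrow> real mat" where
  "mat_exp A = mat (dim_row A) (dim_row A) (\<lambda>(i, j). \<Sum>r. (A ^\<^sub>m r) $$ (i, j) / fact r)"

definition vec_integral :: "nat \<Rightarrow> real set \<Rightarrow> (real \<Rightarrow> real vec) \<Rightarrow> real vec" where
  "vec_integral d S g = vec d (\<lambda>i. integral S (\<lambda>s. g s $ i))"

(* C^1([0,1]), with one-sided derivatives at the end points. A function on [0,1] is represented
   by the function on the reals that is undefined outside [0,1], so that equality in this set is
   equality on [0,1]. *)
definition C1_unit :: "(real \<Rightarrow> real) set" where
  "C1_unit = {u \<in> extensional {0..1}. \<exists>u'.
     (\<forall>t \<in> {0..1}. (u has_real_derivative u' t) (at t within {0..1})) \<and>
     continuous_on {0..1} u'}"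

fun io_map ::
  "nat \<Rightarrow> real mat \<times> real vec \<Rightarrow> real vec \<Rightarrow> (real \<Rightarrow> real) \<Rightarrow> real \<Rightarrow> real" where
  "io_map k (Q, B) x0 =
     (\<lambda>u \<in> C1_unit. \<lambda>t \<in> {0..1}.
        B \<bullet> (Q *\<^sub>v (mat_exp (t \<cdot>\<^sub>m (J_mat k * Q)) *\<^sub>v
          (vec_integral (2 * k) {0..t}
             (\<lambda>s. u s \<cdot>\<^sub>v (mat_exp ((- s) \<cdot>\<^sub>m (J_mat k * Q)) *\<^sub>v B)) + x0))))"

(* The filter is the set of input/output maps, so that systems of different dimensions induce
   the same filter iff these sets are equal. *)
definition induced_filter ::
  "nat \<Rightarrow> real mat \<times> real vec \<Rightarrow> ((real \<Rightarrow> real) \<Rightarrow> real \<Rightarrow> real) set" where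
  "induced_filter k QB = io_map k QB ` carrier_vec (2 * k)"

end

theory Submission
  imports Defs "Jordan_Normal_Form.Determinant"
begin

text \<open>Let \<open>W\<close> be the permutation matrix that turns the block sum of the symplectic forms of sizes
  \<open>n\<close> and \<open>m - n\<close> into \<open>J_mat m\<close>. In the extended system the added coordinates then neither feed
  into the original ones nor appear in the output: the coordinate selection \<open>S\<close>, the first block
  row of the transpose of \<open>W\<close>, intertwines \<open>J_mat m\<close> with \<open>J_mat n\<close> and \<open>Q'\<close> with \<open>Q\<close>, hence also
  the matrix exponentials. The input/output map started at \<open>x\<close> is therefore that of \<open>(Q, B)\<close>
  started at \<open>S x\<close>, and \<open>S\<close> is onto. The morphism is the transpose of \<open>S\<close>, a right inverse of \<open>S\<close>.\<close>

section \<open>Coordinate selection matrices\<close>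

text \<open>One definition covers both the rectangular selection \<open>S\<close> and the square
  permutation matrix whose transpose is \<open>W\<close>; row \<open>i\<close> is the unit vector at
  \<open>\<iota> i\<close>.\<close>

definition sel_mat :: "nat \<Rightarrow> (nat \<Rightarrow> nat) \<Rightarrow> nat \<Rightarrow> real mat" where
  "sel_mat d \<iota> d' = mat d d' (\<lambda>(i, j). if j = \<iota> i then 1 else 0)"

lemma sel_mat_carrier [simp, intro]: "sel_mat d \<iota> d' \<in> carrier_mat d d'"
  and sel_mat_dim [simp]: "dim_row (sel_mat d \<iota> d') = d" "dim_col (sel_mat d \<iota> d') = d'"
  by (auto simp: sel_mat_def)

lemma sel_mat_mult_vec:
  assumes "x \<in> carrier_vec d'" and "i < d" and "\<iota> i < d'"
  shows "(sel_mat d \<iota> d' *\<^sub>v x) $ i = x $ \<iota> i"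
proof -
  have "(sel_mat d \<iota> d' *\<^sub>v x) $ i = (\<Sum>k\<in>{0..<d'}. (if k = \<iota> i then 1 else 0) * x $ k)"
    using assms by (simp add: sel_mat_def scalar_prod_def)
  also have "\<dots> = (\<Sum>k\<in>{0..<d'}. if k = \<iota> i then x $ k else 0)"
    by (rule sum.cong) auto
  finally show ?thesis using assms by simp
qed

lemma sel_mat_mult:
  assumes "A \<in> carrier_mat d' c" and "i < d" and "\<iota> i < d'" and "j < c"
  shows "(sel_mat d \<iota> d' * A) $$ (i, j) = A $$ (\<iota> i, j)"
proof -
  have "(sel_mat d \<iota> d' * A) $$ (i, j) = (sel_mat d \<iota> d' *\<^sub>v col A j) $ i"
    using assms by simp
  also have "\<dots> = A $$ (\<iota> i, j)"
    using assms by (subst sel_mat_mult_vec) auto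
  finally show ?thesis .
qed

text \<open>In the sum defining the product, a column outside the image of \<open>\<iota>\<close>
  meets no nonzero term, and by injectivity the column \<open>\<iota> k\<close> meets only the term
  of index \<open>k\<close>.\<close>

lemma mult_sel_mat:
  assumes X: "X \<in> carrier_mat r d" and i: "i < r"
  shows "j < d' \<Longrightarrow> j \<notin> \<iota> ` {..<d} \<Longrightarrow> (X * sel_mat d \<iota> d') $$ (i, j) = 0"
    and "k < d \<Longrightarrow> inj_on \<iota> {..<d} \<Longrightarrow> \<iota> k < d' \<Longrightarrow> (X * sel_mat d \<iota> d') $$ (i, \<iota> k) = X $$ (i, k)"
proof -
  have sum: "(X * sel_mat d \<iota> d') $$ (i, j) = (\<Sum>l\<in>{0..<d}. if j = \<iota> l then X $$ (i, l) else 0)"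
    if "j < d'" for j
    using X i that by (auto simp: sel_mat_def scalar_prod_def intro!: sum.cong)
  show "(X * sel_mat d \<iota> d') $$ (i, j) = 0" if "j < d'" "j \<notin> \<iota> ` {..<d}"
    using that by (auto simp: sum intro!: sum.neutral)
  assume k: "k < d" "inj_on \<iota> {..<d}" "\<iota> k < d'"
  have "(\<Sum>l\<in>{0..<d}. if \<iota> k = \<iota> l then X $$ (i, l) else 0) =
      (\<Sum>l\<in>{0..<d}. if l = k then X $$ (i, l) else 0)"
    using k by (intro sum.cong) (auto dest: inj_onD)
  then show "(X * sel_mat d \<iota> d') $$ (i, \<iota> k) = X $$ (i, k)"
    using k by (simp add: sum)
qed

text \<open>The rows are distinct unit vectors, hence orthonormal. The square case yields the
  orthogonality of \<open>W\<close>, the rectangular case a right inverse of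
  \<open>S\<close>.\<close>

lemma sel_mat_mult_transpose:
  assumes inj: "inj_on \<iota> {..<d}" and range: "\<iota> ` {..<d} \<subseteq> {..<d'}"
  shows "sel_mat d \<iota> d' * transpose_mat (sel_mat d \<iota> d') = 1\<^sub>m d"
proof (rule eq_matI, goal_cases)
  case (1 i j)
  then have "i < d" "j < d" "\<iota> i < d'" "\<iota> j < d'" using range by auto
  then have "(sel_mat d \<iota> d' * transpose_mat (sel_mat d \<iota> d')) $$ (i, j) = (if \<iota> i = \<iota> j then 1 else 0)"
    by (subst sel_mat_mult) (auto simp: sel_mat_def)
  then show ?case using \<open>i < d\<close> \<open>j < d\<close> inj by (auto dest: inj_onD)
qed auto

section \<open>Intertwining of powers and exponentials\<close>

text \<open>Carrying \<open>S\<close> past one factor at a time extends the relation between the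
  generators to the coefficients of the exponential series.\<close>

lemma pow_mat_intertwine:
  fixes A A' S :: "'a :: comm_semiring_1 mat"
  assumes c: "S \<in> carrier_mat d d'" "A \<in> carrier_mat d d" "A' \<in> carrier_mat d' d'"
    and comm: "S * A' = A * S"
  shows "S * A' ^\<^sub>m r = A ^\<^sub>m r * S"
proof (induction r)
  case 0
  show ?case using c by simp
next
  case (Suc r)
  have P: "A' ^\<^sub>m r \<in> carrier_mat d' d'" "A ^\<^sub>m r \<in> carrier_mat d d" using c by auto
  have "S * A' ^\<^sub>m Suc r = (S * A' ^\<^sub>m r) * A'"
    using assoc_mult_mat[OF c(1) P(1) c(3)] by simp
  also have "\<dots> = A ^\<^sub>m r * (S * A')"
    unfolding Suc using assoc_mult_mat[OF P(2) c(1,3)] by simp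
  also have "\<dots> = A ^\<^sub>m Suc r * S"
    unfolding comm using assoc_mult_mat[OF P(2) c(2,1)] by simp
  finally show ?case .
qed

lemma mat_exp_carrier [simp, intro]: "A \<in> carrier_mat d d \<Longrightarrow> mat_exp A \<in> carrier_mat d d"
  by (auto simp: mat_exp_def)

text \<open>Each entry of either side is a single entry of the exponential, or zero, so the two series
  agree term by term and their convergence plays no role.\<close>
lemma mat_exp_intertwine_sel_mat:
  assumes inj: "inj_on \<iota> {..<d}" and range: "\<iota> ` {..<d} \<subseteq> {..<d'}"
    and A: "A \<in> carrier_mat d d" and A': "A' \<in> carrier_mat d' d'"
    and comm: "sel_mat d \<iota> d' * A' = A * sel_mat d \<iota> d'"
  shows "sel_mat d \<iota> d' * mat_exp A' = mat_exp A * sel_mat d \<iota> d'"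
proof (rule eq_matI, goal_cases)
  case (1 i j)
  then have i: "i < d" "\<iota> i < d'" and j: "j < d'" using A range by (auto simp: mat_exp_def)
  have P: "A' ^\<^sub>m r \<in> carrier_mat d' d'" "A ^\<^sub>m r \<in> carrier_mat d d" for r
    using A A' by auto
  have "(A' ^\<^sub>m r) $$ (\<iota> i, j) = (A ^\<^sub>m r * sel_mat d \<iota> d') $$ (i, j)" for r
    using sel_mat_mult[OF P(1), of i d \<iota> j r] i j pow_mat_intertwine[OF sel_mat_carrier A A' comm, of r]
    by simp
  then have L: "(sel_mat d \<iota> d' * mat_exp A') $$ (i, j) =
      (\<Sum>r. (A ^\<^sub>m r * sel_mat d \<iota> d') $$ (i, j) / fact r)"
    using A' i j by (subst sel_mat_mult[where c = d']) (auto simp: mat_exp_def)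
  show ?case
  proof (cases "j \<in> \<iota> ` {..<d}")
    case True
    then obtain k where k: "k < d" "j = \<iota> k" by auto
    show ?thesis unfolding L using A k i j inj
      by (simp add: mult_sel_mat(2)[OF P(2)] mult_sel_mat(2)[where r = d] del: index_mult_mat)
        (simp add: mat_exp_def)
  next
    case False
    then show ?thesis unfolding L using A i j
      by (simp add: mult_sel_mat(1)[OF P(2)] mult_sel_mat(1)[where r = d] del: index_mult_mat)
  qed
qed (use A A' in \<open>auto simp: mat_exp_def\<close>)

section \<open>Symplectic forms and the reordering of coordinates\<close>

lemma J_mat_carrier [simp, intro]: "J_mat k \<in> carrier_mat (2 * k) (2 * k)"
  unfolding J_mat_def mult_2 by auto

lemma J_mat_dim [simp]: "dim_row (J_mat k) = 2 * k" "dim_col (J_mat k) = 2 * k"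
  using J_mat_carrier[of k] by (simp_all only: carrier_matD)

lemma J_mat_index:
  assumes "i < 2 * k" "j < 2 * k"
  shows "J_mat k $$ (i, j) = (if j = i + k then 1 else if i = j + k then - 1 else 0)"
  using assms unfolding J_mat_def by auto

text \<open>Skew-symmetry serves to pass from the intertwining by \<open>S\<close> to the one by its
  transpose.\<close>

lemma transpose_J_mat: "transpose_mat (J_mat k) = - J_mat k"
proof (rule eq_matI, goal_cases)
  case (1 i j)
  then have "i < 2 * k" "j < 2 * k" using J_mat_carrier[of k] by auto
  then show ?case using J_mat_carrier[of k] by (simp add: J_mat_index)
qed (use J_mat_carrier in auto)

text \<open>With \<open>l = m - n\<close>, coordinates \<open>(q, p, q', p')\<close> of block sizes \<open>n, n, l, l\<close> are sent to the
  normal-form order \<open>(q, q', p, p')\<close>, so that \<open>J_mat m\<close> pulls back to the block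
  sum of \<open>J_mat n\<close> and \<open>J_mat l\<close>.\<close>
definition shuffle :: "nat \<Rightarrow> nat \<Rightarrow> nat \<Rightarrow> nat" where
  "shuffle n m i = (if i < n then i else if i < 2 * n then i + m - n else if i < m + n then i - n else i)"

lemma shuffle_less: "n \<le> m \<Longrightarrow> i < 2 * m \<Longrightarrow> shuffle n m i < 2 * m"
  by (auto simp: shuffle_def)

lemma inj_on_shuffle:
  assumes "n \<le> m" shows "inj_on (shuffle n m) {..<2 * m}"
  using assms by (auto simp: inj_on_def shuffle_def split: if_splits)

text \<open>\<open>J_mat m\<close> pairs each index below \<open>m\<close> with the one
  \<open>m\<close> places higher. The first \<open>2 * n\<close> indices are sent to a union of such
  pairs, on which \<open>J_mat m\<close> acts as \<open>J_mat n\<close>.\<close>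

lemma shuffle_J_mat:
  assumes "n \<le> m"
  shows "sel_mat (2 * n) (shuffle n m) (2 * m) * J_mat m = J_mat n * sel_mat (2 * n) (shuffle n m) (2 * m)"
    (is "?S * _ = _")
proof (rule eq_matI, goal_cases)
  case (1 i j)
  then have i: "i < 2 * n" and j: "j < 2 * m" using J_mat_carrier[of n] by auto
  have inj: "inj_on (shuffle n m) {..<2 * n}"
    using inj_on_shuffle[OF assms] by (rule inj_on_subset) (use assms in auto)
  have less: "shuffle n m k < 2 * m" if "k < 2 * n" for k
    using shuffle_less[OF assms] assms that by simp
  have L: "(?S * J_mat m) $$ (i, j) = J_mat m $$ (shuffle n m i, j)"
    using i j less by (subst sel_mat_mult[where c = "2 * m"]) auto
  show ?case
  proof (cases "j \<in> shuffle n m ` {..<2 * n}")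
    case True
    then obtain k where k: "k < 2 * n" "j = shuffle n m k" by auto
    have "(J_mat n * ?S) $$ (i, j) = J_mat n $$ (i, k)"
      unfolding k(2) using i k inj less by (intro mult_sel_mat(2)) auto
    also have "\<dots> = J_mat m $$ (shuffle n m i, j)"
      using i k assms less by (auto simp: J_mat_index shuffle_def)
    finally show ?thesis using L by simp
  next
    case False
    have "(J_mat n * ?S) $$ (i, j) = 0"
      using i j False by (intro mult_sel_mat(1)) auto
    \<comment> \<open>The partner of \<open>shuffle n m i\<close> is the image of
      \<open>i + n\<close> or of \<open>i - n\<close>. A column outside the image is therefore never
      the partner, and its entry vanishes.\<close>
    moreover have "shuffle n m i + m \<noteq> j" if "i < n"
      using that False assms by (auto simp: shuffle_def intro: rev_image_eqI[of "i + n"])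
    moreover have "shuffle n m i \<noteq> j + m" if "\<not> i < n"
      using that i False assms by (auto simp: shuffle_def intro: rev_image_eqI[of "i - n"])
    ultimately show ?thesis
      using L i j less assms by (auto simp: J_mat_index shuffle_def split: if_splits)
  qed
qed (use J_mat_carrier in auto)

section \<open>Positive definiteness of the extended Hamiltonian\<close>

text \<open>Splitting the vector as \<open>(y, z)\<close> splits the form into that of
  \<open>Q\<close> at \<open>y\<close> plus the squared norm of \<open>z\<close>, and
  \<open>y\<close>, \<open>z\<close> are not both zero.\<close>

lemma pos_def_mat_block_one:
  assumes "pos_def_mat d Q"
  shows "pos_def_mat (d + l) (four_block_mat Q (0\<^sub>m d l) (0\<^sub>m l d) (1\<^sub>m l))" (is "pos_def_mat _ ?D")
  unfolding pos_def_mat_def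
proof (intro conjI ballI impI)
  have Q: "Q \<in> carrier_mat d d" "transpose_mat Q = Q"
    and pos: "\<And>x. x \<in> carrier_vec d \<Longrightarrow> x \<noteq> 0\<^sub>v d \<Longrightarrow> x \<bullet> (Q *\<^sub>v x) > 0"
    using assms by (auto simp: pos_def_mat_def)
  show "?D \<in> carrier_mat (d + l) (d + l)" using Q by auto
  show "transpose_mat ?D = ?D"
    using Q by (subst transpose_four_block_mat) auto
  fix x :: "real vec" assume x: "x \<in> carrier_vec (d + l)" "x \<noteq> 0\<^sub>v (d + l)"
  define y z where "y = vec_first x d" and "z = vec_last x l"
  have yz: "y \<in> carrier_vec d" "z \<in> carrier_vec l" "x = y @\<^sub>v z"
    using x by (auto simp: y_def z_def)
  have "?D *\<^sub>v x = (Q *\<^sub>v y) @\<^sub>v z"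
    unfolding yz(3) using Q yz by (subst four_block_mat_mult_vec) auto
  then have eq: "x \<bullet> (?D *\<^sub>v x) = y \<bullet> (Q *\<^sub>v y) + z \<bullet> z"
    unfolding yz(3) using Q yz(1,2) by (simp add: scalar_prod_append[of _ d _ l])
  show "x \<bullet> (?D *\<^sub>v x) > 0"
  proof (cases "y = 0\<^sub>v d")
    case True
    then have "z \<noteq> 0\<^sub>v l" using x(2) yz by auto
    then obtain i where i: "i < l" "z $ i \<noteq> 0" using yz(2) by (metis carrier_vecD eq_vecI index_zero_vec)
    then have "z \<bullet> z > 0"
      using yz(2) by (auto simp: scalar_prod_def zero_less_mult_iff intro!: sum_pos2[of _ i])
    then show ?thesis using eq True Q by simp
  next
    case False
    moreover have "z \<bullet> z \<ge> 0" by (auto simp: scalar_prod_def intro: sum_nonneg)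
    ultimately show ?thesis using eq pos[of y] yz(1) by simp
  qed
qed

text \<open>The form at \<open>x\<close> is that of \<open>D\<close> at \<open>y\<close>, the
  product of the transpose of \<open>W\<close> with \<open>x\<close>; this \<open>y\<close> is
  nonzero because \<open>W\<close> maps it back to \<open>x\<close>.\<close>

lemma pos_def_mat_congruence:
  assumes D: "pos_def_mat d D" and W: "W \<in> orthogonal_group d"
  shows "pos_def_mat d (W * D * transpose_mat W)"
  unfolding pos_def_mat_def
proof (intro conjI ballI impI)
  have c: "W \<in> carrier_mat d d" "D \<in> carrier_mat d d" "transpose_mat W \<in> carrier_mat d d"
    and sym: "transpose_mat D = D"
    using assms by (auto simp: pos_def_mat_def orthogonal_group_def)
  \<comment> \<open>Membership in the group provides only the left inverse; for square matrices it
    is also a right inverse.\<close>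
  have inv: "W * transpose_mat W = 1\<^sub>m d"
    using mat_mult_left_right_inverse[OF c(3) c(1)] W by (simp add: orthogonal_group_def)
  show "W * D * transpose_mat W \<in> carrier_mat d d" using c by auto
  show "transpose_mat (W * D * transpose_mat W) = W * D * transpose_mat W"
    using c sym transpose_mult[OF mult_carrier_mat[OF c(1,2)] c(3)] transpose_mult[OF c(1,2)]
      assoc_mult_mat[OF c(1,2,3)] by simp
  fix x :: "real vec" assume x: "x \<in> carrier_vec d" "x \<noteq> 0\<^sub>v d"
  define y where "y = transpose_mat W *\<^sub>v x"
  have y: "y \<in> carrier_vec d" using c x by (auto simp: y_def)
  have "W *\<^sub>v y = x" unfolding y_def using assoc_mult_mat_vec[OF c(1,3) x(1)] inv x by simp
  then have "y \<noteq> 0\<^sub>v d" using x c by auto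
  then have "y \<bullet> (D *\<^sub>v y) > 0" using D y by (auto simp: pos_def_mat_def)
  moreover have "(W * D * transpose_mat W) *\<^sub>v x = W *\<^sub>v (D *\<^sub>v y)"
    using assoc_mult_mat_vec[OF mult_carrier_mat[OF c(1,2)] c(3) x(1)] assoc_mult_mat_vec[OF c(1,2) y]
    by (simp only: y_def)
  ultimately show "x \<bullet> ((W * D * transpose_mat W) *\<^sub>v x) > 0"
    using transpose_vec_mult_scalar[OF c(1) _ x(1), of "D *\<^sub>v y"] c y by (simp add: y_def)
qed

section \<open>Transfer of the input/output map\<close>

text \<open>\<open>S\<close> carries the drift, the input vector and the readout of the large system
  to those of the small one, so it carries each trajectory to the one started at the selected
  initial state.\<close>

lemma io_map_sel_mat:
  assumes inj: "inj_on \<iota> {..<2 * n}" and range: "\<iota> ` {..<2 * n} \<subseteq> {..<2 * m}"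
    and Q: "Q \<in> carrier_mat (2 * n) (2 * n)" and Q': "Q' \<in> carrier_mat (2 * m) (2 * m)"
    and B: "B \<in> carrier_vec (2 * n)" and x0: "x0 \<in> carrier_vec (2 * m)"
    and S: "S = sel_mat (2 * n) \<iota> (2 * m)"
    and SJ: "S * J_mat m = J_mat n * S" and SQ: "S * Q' = Q * S"
  shows "io_map m (Q', transpose_mat S *\<^sub>v B) x0 = io_map n (Q, B) (S *\<^sub>v x0)"
proof -
  define A A' where "A = J_mat n * Q" and "A' = J_mat m * Q'"
  let ?B = "transpose_mat S *\<^sub>v B"
  have Sc: "S \<in> carrier_mat (2 * n) (2 * m)" unfolding S by simp
  have STc: "transpose_mat S \<in> carrier_mat (2 * m) (2 * n)" using Sc by simp
  have Bc: "?B \<in> carrier_vec (2 * m)" using STc B by simp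
  have Ac: "A \<in> carrier_mat (2 * n) (2 * n)" and A'c: "A' \<in> carrier_mat (2 * m) (2 * m)"
    using Q Q' by (auto simp: A_def A'_def)
  have "S * A' = J_mat n * (S * Q')"
    unfolding A'_def using assoc_mult_mat[OF Sc J_mat_carrier Q'] assoc_mult_mat[OF J_mat_carrier Sc Q'] SJ by simp
  then have SA: "S * A' = A * S"
    unfolding A_def SQ using assoc_mult_mat[OF J_mat_carrier Q Sc] by simp
  have SE: "S *\<^sub>v (mat_exp (t \<cdot>\<^sub>m A') *\<^sub>v x) = mat_exp (t \<cdot>\<^sub>m A) *\<^sub>v (S *\<^sub>v x)"
    if x: "x \<in> carrier_vec (2 * m)" for t x
  proof -
    have "S * (t \<cdot>\<^sub>m A') = (t \<cdot>\<^sub>m A) * S"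
      using SA Sc Ac A'c by (simp add: mult_smult_distrib mult_smult_assoc_mat)
    then have "S * mat_exp (t \<cdot>\<^sub>m A') = mat_exp (t \<cdot>\<^sub>m A) * S"
      unfolding S using Ac A'c by (intro mat_exp_intertwine_sel_mat[OF inj range]) auto
    then show ?thesis
      using assoc_mult_mat_vec[OF Sc mat_exp_carrier x, of "t \<cdot>\<^sub>m A'"]
        assoc_mult_mat_vec[OF mat_exp_carrier Sc x, of "t \<cdot>\<^sub>m A"] Ac A'c by simp
  qed
  have SB: "S *\<^sub>v ?B = B"
    using assoc_mult_mat_vec[OF Sc STc B] sel_mat_mult_transpose[OF inj range] B by (simp add: S)
  \<comment> \<open>Row \<open>i\<close> of \<open>S\<close> picks the single coordinate
    \<open>\<iota> i\<close>, so it passes under the coordinatewise integral by plain equality of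
    the integrands.\<close>
  have vint: "S *\<^sub>v vec_integral (2 * m) {0..t} (\<lambda>s. u s \<cdot>\<^sub>v (mat_exp ((- s) \<cdot>\<^sub>m A') *\<^sub>v ?B)) =
      vec_integral (2 * n) {0..t} (\<lambda>s. u s \<cdot>\<^sub>v (mat_exp ((- s) \<cdot>\<^sub>m A) *\<^sub>v B))" for u t
  proof (rule eq_vecI, goal_cases)
    case (1 i)
    then have i: "i < 2 * n" "\<iota> i < 2 * m" using range by (auto simp: vec_integral_def)
    have "(mat_exp ((- s) \<cdot>\<^sub>m A') *\<^sub>v ?B) $ \<iota> i = (mat_exp ((- s) \<cdot>\<^sub>m A) *\<^sub>v B) $ i" for s
    proof -
      have "mat_exp ((- s) \<cdot>\<^sub>m A') *\<^sub>v ?B \<in> carrier_vec (2 * m)"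
        by (rule mult_mat_vec_carrier[OF mat_exp_carrier Bc]) (use A'c in auto)
      from sel_mat_mult_vec[OF this, of i "2 * n" \<iota>] show ?thesis
        using i SE[OF Bc, of "- s"] SB by (simp add: S del: index_mult_mat_vec)
    qed
    moreover have "dim_vec (mat_exp ((- s) \<cdot>\<^sub>m A') *\<^sub>v ?B) = 2 * m"
      "dim_vec (mat_exp ((- s) \<cdot>\<^sub>m A) *\<^sub>v B) = 2 * n" for s
      using Ac A'c by (simp_all add: mat_exp_def)
    ultimately show ?case
      unfolding S using i by (subst sel_mat_mult_vec) (auto simp: vec_integral_def simp del: index_mult_mat_vec)
  qed (use Sc in \<open>auto simp: vec_integral_def\<close>)
  have readout: "?B \<bullet> (Q' *\<^sub>v x) = B \<bullet> (Q *\<^sub>v (S *\<^sub>v x))" if x: "x \<in> carrier_vec (2 * m)" for x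
  proof -
    have "?B \<bullet> (Q' *\<^sub>v x) = B \<bullet> (S *\<^sub>v (Q' *\<^sub>v x))"
      using transpose_vec_mult_scalar[OF Sc _ B, of "Q' *\<^sub>v x"] Q' x by simp
    also have "S *\<^sub>v (Q' *\<^sub>v x) = Q *\<^sub>v (S *\<^sub>v x)"
      using assoc_mult_mat_vec[OF Sc Q' x] assoc_mult_mat_vec[OF Q Sc x] SQ by simp
    finally show ?thesis .
  qed
  have "?B \<bullet> (Q' *\<^sub>v (mat_exp (t \<cdot>\<^sub>m A') *\<^sub>v
          (vec_integral (2 * m) {0..t} (\<lambda>s. u s \<cdot>\<^sub>v (mat_exp ((- s) \<cdot>\<^sub>m A') *\<^sub>v ?B)) + x0))) =
        B \<bullet> (Q *\<^sub>v (mat_exp (t \<cdot>\<^sub>m A) *\<^sub>v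
          (vec_integral (2 * n) {0..t} (\<lambda>s. u s \<cdot>\<^sub>v (mat_exp ((- s) \<cdot>\<^sub>m A) *\<^sub>v B)) + S *\<^sub>v x0)))"
    (is "?B \<bullet> (Q' *\<^sub>v (?E *\<^sub>v (?V + x0))) = _") for t u
  proof -
    have V: "?V \<in> carrier_vec (2 * m)" by (simp add: vec_integral_def)
    then have Vx: "?V + x0 \<in> carrier_vec (2 * m)" using x0 by simp
    have "?E *\<^sub>v (?V + x0) \<in> carrier_vec (2 * m)"
      by (rule mult_mat_vec_carrier[OF mat_exp_carrier Vx]) (use A'c in auto)
    \<comment> \<open>The selection travels inwards: past the readout, past the outer exponential,
      then onto the integral and the initial state separately.\<close>
    from readout[OF this] show ?thesis
      by (simp only: SE[OF Vx] mult_add_distrib_mat_vec[OF Sc V x0] vint)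
  qed
  then show ?thesis by (simp only: io_map.simps A_def[symmetric] A'_def[symmetric])
qed

section \<open>Assembly of the extended system\<close>

theorem theorem5p1:
  fixes n m :: nat and Q :: "real mat" and B :: "real vec"
  assumes "n \<ge> 1"
    and "(Q, B) \<in> PH n"
    and "m \<ge> n"
  shows "\<exists>W \<in> orthogonal_group (2 * m).
    let Q' = W * four_block_mat
                   Q (0\<^sub>m (2 * n) (2 * m - 2 * n))
                   (0\<^sub>m (2 * m - 2 * n) (2 * n)) (1\<^sub>m (2 * m - 2 * n))
               * transpose_mat W;
        B' = W *\<^sub>v (B @\<^sub>v 0\<^sub>v (2 * m - 2 * n));
        f = (\<lambda>z. (W * (1\<^sub>m (2 * n) @\<^sub>r 0\<^sub>m (2 * m - 2 * n) (2 * n))) *\<^sub>v z)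
    in (Q', B') \<in> PH m
     \<and> induced_filter m (Q', B') = induced_filter n (Q, B)
     \<and> system_morphism (PH_system n (Q, B)) (PH_system m (Q', B')) f
     \<and> inj_on f (carrier_vec (2 * n))"
proof -
  \<comment> \<open>The transpose makes \<open>W\<close> push coordinate \<open>i\<close> forward to
    position \<open>shuffle n m i\<close>. Below, \<open>S\<close> is the first \<open>2 * n\<close>
    rows of its transpose, and \<open>P\<close> the first \<open>2 * n\<close> columns of
    \<open>W\<close>.\<close>
  define W where "W = transpose_mat (sel_mat (2 * m) (shuffle n m) (2 * m))"
  define S where "S = sel_mat (2 * n) (shuffle n m) (2 * m)"
  define P where "P = transpose_mat S"
  define E :: "real mat" where "E = 1\<^sub>m (2 * n) @\<^sub>r 0\<^sub>m (2 * m - 2 * n) (2 * n)"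
  define D where "D = four_block_mat Q (0\<^sub>m (2 * n) (2 * m - 2 * n))
    (0\<^sub>m (2 * m - 2 * n) (2 * n)) (1\<^sub>m (2 * m - 2 * n))"
  define Q' where "Q' = W * D * transpose_mat W"
  \<comment> \<open>As \<open>n \<le> m\<close>, the truncated subtraction is exact and the block
    sizes add up.\<close>
  have dims: "2 * n + (2 * m - 2 * n) = 2 * m" using assms(3) by simp
  have Q: "pos_def_mat (2 * n) Q" and B: "B \<in> carrier_vec (2 * n)"
    using assms(2) by (auto simp: PH_def)
  have Qc: "Q \<in> carrier_mat (2 * n) (2 * n)" and Qsym: "transpose_mat Q = Q"
    using Q by (auto simp: pos_def_mat_def)
  have inj: "inj_on (shuffle n m) {..<2 * m}" using inj_on_shuffle[OF assms(3)] .
  have inj': "inj_on (shuffle n m) {..<2 * n}"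
    using inj by (rule inj_on_subset) (use assms in auto)
  have less: "shuffle n m k < 2 * m" if "k < 2 * m" for k
    using shuffle_less[OF assms(3) that] .
  have range': "shuffle n m ` {..<2 * n} \<subseteq> {..<2 * m}"
    using less assms(3) by force
  have Sc: "S \<in> carrier_mat (2 * n) (2 * m)" and Pc: "P \<in> carrier_mat (2 * m) (2 * n)"
    and Wc: "W \<in> carrier_mat (2 * m) (2 * m)" and WTc: "transpose_mat W \<in> carrier_mat (2 * m) (2 * m)"
    by (auto simp: S_def P_def W_def)
  have WW: "transpose_mat W * W = 1\<^sub>m (2 * m)"
    unfolding W_def transpose_transpose by (rule sel_mat_mult_transpose[OF inj]) (use less in auto)
  then have W: "W \<in> orthogonal_group (2 * m)" using Wc by (simp add: orthogonal_group_def)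
  have Ec: "E \<in> carrier_mat (2 * m) (2 * n)"
    unfolding E_def using carrier_append_rows[of "1\<^sub>m (2 * n)" "2 * n" "2 * n" "0\<^sub>m (2 * m - 2 * n) (2 * n)" "2 * m - 2 * n"] dims
    by simp
  have SP: "S * P = 1\<^sub>m (2 * n)"
    unfolding P_def S_def by (rule sel_mat_mult_transpose[OF inj' range'])
  have Ei: "E $$ (i, j) = (if i = j then 1 else 0)" if "i < 2 * m" "j < 2 * n" for i j
    using that dims by (auto simp: E_def append_rows_def)
  have XE: "(X * E) $$ (i, j) = X $$ (i, j)"
    if "X \<in> carrier_mat (2 * m) (2 * m)" "i < 2 * m" "j < 2 * n" for X i j
  proof -
    have "(X * E) $$ (i, j) = (\<Sum>k\<in>{0..<2 * m}. X $$ (i, k) * E $$ (k, j))"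
      using that Ec by (simp add: scalar_prod_def)
    also have "\<dots> = (\<Sum>k\<in>{0..<2 * m}. if k = j then X $$ (i, k) else 0)"
      using that by (intro sum.cong) (auto simp: Ei)
    finally show ?thesis using that dims by simp
  qed
  have WE: "W * E = P"
  proof (rule eq_matI, goal_cases)
    case (1 i j)
    then have ij: "i < 2 * m" "j < 2 * n" "j < 2 * m" using Pc dims by auto
    have "W $$ (i, j) = P $$ (i, j)" using ij by (simp add: W_def P_def S_def sel_mat_def)
    then show ?case using XE[OF Wc ij(1,2)] by simp
  qed (use Wc Ec Pc in auto)
  have D: "pos_def_mat (2 * m) D"
    using pos_def_mat_block_one[OF Q, of "2 * m - 2 * n"] by (simp only: dims D_def)
  then have Dc: "D \<in> carrier_mat (2 * m) (2 * m)" by (simp add: pos_def_mat_def)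
  have Q': "pos_def_mat (2 * m) Q'"
    unfolding Q'_def by (rule pos_def_mat_congruence[OF D W])
  then have Q'c: "Q' \<in> carrier_mat (2 * m) (2 * m)" and Q'sym: "transpose_mat Q' = Q'"
    by (auto simp: pos_def_mat_def)
  \<comment> \<open>\<open>D\<close> is block diagonal, so on the first \<open>2 * n\<close>
    coordinates, included by \<open>E\<close>, it acts as \<open>Q\<close>.\<close>
  have DE: "D * E = E * Q"
  proof (rule eq_matI, goal_cases)
    case (1 i j)
    then have ij: "i < 2 * m" "j < 2 * n" "j < 2 * m" using Ec Qc dims by auto
    have "(D * E) $$ (i, j) = D $$ (i, j)"
      by (rule XE[OF Dc ij(1,2)])
    also have "\<dots> = (if i < 2 * n then Q $$ (i, j) else 0)"
      using ij Qc dims by (auto simp: D_def)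
    also have "\<dots> = (\<Sum>k\<in>{0..<2 * n}. if k = i then Q $$ (k, j) else 0)"
      using ij by simp
    also have "\<dots> = (\<Sum>k\<in>{0..<2 * n}. E $$ (i, k) * Q $$ (k, j))"
      using ij by (intro sum.cong) (auto simp: Ei)
    also have "\<dots> = (E * Q) $$ (i, j)"
      using ij Qc Ec by (simp add: scalar_prod_def)
    finally show ?case .
  qed (use Dc Ec Qc in auto)
  have zero: "0\<^sub>m (2 * m - 2 * n) (2 * n) *\<^sub>v B = 0\<^sub>v (2 * m - 2 * n)"
    using B by (intro eq_vecI) auto
  have EB: "B @\<^sub>v 0\<^sub>v (2 * m - 2 * n) = E *\<^sub>v B"
    unfolding E_def using mat_mult_append[of "1\<^sub>m (2 * n)" "2 * n" "2 * n" "0\<^sub>m (2 * m - 2 * n) (2 * n)" "2 * m - 2 * n" B] B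
    by (simp add: zero)
  have WEB: "W *\<^sub>v (B @\<^sub>v 0\<^sub>v (2 * m - 2 * n)) = P *\<^sub>v B"
    unfolding EB WE[symmetric] using assoc_mult_mat_vec[OF Wc Ec B] by simp
  have "transpose_mat W * P = E"
    unfolding WE[symmetric] using assoc_mult_mat[OF WTc Wc Ec] WW Ec by simp
  \<comment> \<open>With \<open>P = W * E\<close>, orthogonality cancels the inner \<open>W\<close>,
    leaving \<open>W * D * E = W * E * Q\<close>.\<close>
  then have QP: "Q' * P = P * Q"
    unfolding Q'_def using assoc_mult_mat[OF mult_carrier_mat[OF Wc Dc] WTc Pc]
      assoc_mult_mat[OF Wc Dc Ec] assoc_mult_mat[OF Wc Ec Qc] DE WE by simp
  \<comment> \<open>Both Hamiltonian matrices are symmetric, so transposing the previous relation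
    exchanges \<open>P\<close> for \<open>S\<close>.\<close>
  then have SQ: "S * Q' = Q * S"
    using transpose_mult[OF Q'c Pc] transpose_mult[OF Pc Qc] Qsym Q'sym by (simp add: P_def)
  have SJ: "S * J_mat m = J_mat n * S" unfolding S_def by (rule shuffle_J_mat[OF assms(3)])
  \<comment> \<open>Transposing \<open>SJ\<close> introduces a minus sign on both sides by
    skew-symmetry; the signs cancel to give \<open>JP\<close>.\<close>
  have "transpose_mat (J_mat m) * P = P * transpose_mat (J_mat n)"
    using transpose_mult[OF Sc J_mat_carrier] transpose_mult[OF J_mat_carrier Sc] SJ by (simp add: P_def)
  then have "- (J_mat m * P) = - (P * J_mat n)"
    unfolding transpose_J_mat using J_mat_carrier Pc
    by (simp add: uminus_mult_left_mat uminus_mult_right_mat)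
  then have JP: "J_mat m * P = P * J_mat n"
    by (metis uminus_uminus_mat)
  have "J_mat m * Q' * P = P * J_mat n * Q"
    using assoc_mult_mat[OF J_mat_carrier Q'c Pc] assoc_mult_mat[OF J_mat_carrier Pc Qc] QP JP by simp
  then have AP: "J_mat m * Q' * P = P * (J_mat n * Q)"
    using assoc_mult_mat[OF Pc J_mat_carrier Qc] by simp
  have SPv: "S *\<^sub>v (P *\<^sub>v z) = z" if "z \<in> carrier_vec (2 * n)" for z
    using assoc_mult_mat_vec[OF Sc Pc that] SP that by simp
  have "(Q', P *\<^sub>v B) \<in> PH m" using Q' Pc B by (auto simp: PH_def)
  moreover have "induced_filter m (Q', P *\<^sub>v B) = induced_filter n (Q, B)"
  proof -
    have io: "io_map m (Q', P *\<^sub>v B) x = io_map n (Q, B) (S *\<^sub>v x)" if "x \<in> carrier_vec (2 * m)" for x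
      unfolding P_def by (rule io_map_sel_mat[OF inj' range' Qc Q'c B that S_def SJ SQ])
    \<comment> \<open>Surjectivity, with preimage \<open>P *\<^sub>v z\<close>, makes every initial
      state of the small system occur, so the two sets of maps are equal.\<close>
    have "(\<lambda>x. S *\<^sub>v x) ` carrier_vec (2 * m) = carrier_vec (2 * n)"
    proof (intro equalityI subsetI)
      fix z :: "real vec" assume "z \<in> carrier_vec (2 * n)"
      then show "z \<in> (\<lambda>x. S *\<^sub>v x) ` carrier_vec (2 * m)"
        using Pc by (intro image_eqI[of _ _ "P *\<^sub>v z"]) (auto simp: SPv)
    qed (use Sc in auto)
    then show ?thesis
      unfolding induced_filter_def by (metis (no_types, lifting) image_cong image_image io)
  qed
  moreover have "system_morphism (PH_system n (Q, B)) (PH_system m (Q', P *\<^sub>v B)) (\<lambda>z. P *\<^sub>v z)"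
    unfolding system_morphism_def
  proof (intro conjI ballI allI, goal_cases)
    case (1 z)
    then show ?case using Pc by simp
  next
    case (2 z u)
    then have z: "z \<in> carrier_vec (2 * n)" by simp
    have c: "J_mat n * Q \<in> carrier_mat (2 * n) (2 * n)" "J_mat m * Q' \<in> carrier_mat (2 * m) (2 * m)"
      using Qc Q'c by auto
    have "P *\<^sub>v ((J_mat n * Q) *\<^sub>v z + u \<cdot>\<^sub>v B) = P *\<^sub>v ((J_mat n * Q) *\<^sub>v z) + u \<cdot>\<^sub>v (P *\<^sub>v B)"
      using mult_add_distrib_mat_vec[OF Pc mult_mat_vec_carrier[OF c(1) z], of "u \<cdot>\<^sub>v B"]
        mult_mat_vec[OF Pc B] B by simp
    also have "P *\<^sub>v ((J_mat n * Q) *\<^sub>v z) = (J_mat m * Q') *\<^sub>v (P *\<^sub>v z)"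
      using assoc_mult_mat_vec[OF Pc c(1) z] assoc_mult_mat_vec[OF c(2) Pc z] AP by simp
    finally show ?case by simp
  next
    case (3 z u)
    then have z: "z \<in> carrier_vec (2 * n)" by simp
    \<comment> \<open>The readout is preserved because \<open>Q'\<close> passes through
      \<open>P\<close> as \<open>Q\<close>, and \<open>S * P = 1\<^sub>m (2 * n)\<close> makes
      \<open>P\<close> preserve scalar products.\<close>
    have "(P *\<^sub>v B) \<bullet> (Q' *\<^sub>v (P *\<^sub>v z)) = (P *\<^sub>v B) \<bullet> (P *\<^sub>v (Q *\<^sub>v z))"
      using assoc_mult_mat_vec[OF Q'c Pc z] assoc_mult_mat_vec[OF Pc Qc z] QP by simp
    also have "\<dots> = B \<bullet> (S *\<^sub>v (P *\<^sub>v (Q *\<^sub>v z)))"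
      using transpose_vec_mult_scalar[OF Sc _ B, of "P *\<^sub>v (Q *\<^sub>v z)"] Pc Qc z by (simp add: P_def)
    also have "\<dots> = B \<bullet> (Q *\<^sub>v z)" using SPv[of "Q *\<^sub>v z"] Qc z by simp
    finally show ?case by simp
  qed
  moreover have "inj_on (\<lambda>z. P *\<^sub>v z) (carrier_vec (2 * n))"
    by (rule inj_on_inverseI[where g = "\<lambda>x. S *\<^sub>v x"]) (rule SPv)
  ultimately show ?thesis
    using W by (intro bexI[of _ W])
      (simp_all only: Let_def WEB WE D_def[symmetric] E_def[symmetric] Q'_def[symmetric])
qed

end
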